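(* For a sequence $(\lambda_n)_{n\ge1}$ of reals with $\lambda_n\ge1$ and $$\prod_{j=1}^n\lambda_j\to\infty\quad\text{as } n\to\infty, \qquad ( * )$$ let $(R_n)$ and $f:\mathbb{R}^3\to\mathbb{R}^3$ be the sequence of radii and the quasiregular map constructed from $(\lambda_n)$ as described in the context, and let $M(r,f)=\max_{|x|=r}|f(x)|$. (1) For any real sequence $(\eta_k)_{k\ge1}$, one may choose $(\lambda_n)$ with $\lambda_n\ge1$ satisfying $( * )$ so that there exists a sequence $r_k\to\infty$ with $r_k<2^k$ and $$\frac{\log\log M(r_k,f)}{\log r_k}\ge\eta_k\quad\text{for all } k\ge1.$$ (2) For any positive sequence $(\epsilon_k)$, one may choose $(\lambda_n)$ with $\lambda_n\ge1$ satisfying $( * )$ such that $$\frac{\log\log M(R_k,f)}{\log R_k}\le\epsilon_k\quad\text{for all } k\ge2.$$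
   Context: $B(y,r)$ is an open ball, $A(r,s)=\{x\in\mathbb{R}^3:r\le|x|\le s\}$, and $R_H$ is reflection in a plane $H$. Zorich and power maps. Fix a bi-Lipschitz map $h$ from $[-1,1]^2$ onto $\{y\in\mathbb{R}^3:|y|=1,\ y_3\ge0\}$ with $h(0,0)=(0,0,1)$, put $\mathcal{Z}(x_1,x_2,x_3)=e^{x_3}h(x_1,x_2)$ on $[-1,1]^2\times\mathbb{R}$, and extend to $\mathcal{Z}:\mathbb{R}^3\to\mathbb{R}^3\setminus\{0\}$ by $\mathcal{Z}(R_{\{x_i=n\}}(x))=R_{\{x_3=0\}}(\mathcal{Z}(x))$ for $i\in\{1,2\}$ and $n$ odd ($h$ oriented so that $\mathcal{Z}$ is orientation-preserving, hence quasiregular). For odd $d\in\mathbb{N}$, $p_d:\mathbb{R}^3\to\mathbb{R}^3$ is the unique quasiregular map with $p_d(\mathcal{Z}(x))=\mathcal{Z}(dx)$; $p_d(0)=0$ and $|p_d(x)|=|x|^d$. Interpolating map $P$ (for odd $d$). On the prism $0\le x_1\le x_2\le1$, $0\le x_3\le1$ let $\Delta_j$ be the convex hull of $(0,0,1)$ and the triangle $T_j$, where $T_1,\dots,T_5$ have vertices $\{(0,0,0),(1,1,0),(0,1,0)\}$, $\{(0,1,0),(1,1,0),(0,1,\frac12)\}$, $\{(1,1,0),(0,1,\frac12),(1,1,\frac12)\}$, $\{(0,1,\frac12),(1,1,\frac12),(0,1,1)\}$, $\{(0,1,1),(1,1,\frac12),(1,1,1)\}$. Put $\alpha'(x)=(x_1,x_2,3x_3)$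 on $\Delta_1$; $(x_1,5x_2+4x_3-4,3-3x_2)$ on $\Delta_2$; $(3x_1+2x_2+4x_3-4,5x_2+4x_3-4,3-3x_2)$ on $\Delta_3$; $(3x_1,3x_2,6x_3-3)$ on $\Delta_4\cup\Delta_5$; extend to $[-1,1]^2\times[0,1]$ by $\alpha'\circ R_H=R_H\circ\alpha'$ for $H$ each of $\{x_1=0\},\{x_2=0\},\{x_1=x_2\},\{x_1=-x_2\}$. Let $F=\bigcup_{i\in\mathbb{Z}}\mathbb{R}\times\{2i-1\}\times[0,\frac12)\cup\bigcup_{j\in\mathbb{Z}}\{2j-1\}\times\mathbb{R}\times[0,\frac12)$ and extend $\alpha'$ to $\alpha:(\mathbb{R}^2\times[0,1])\setminus F\to\mathbb{R}^2\times[0,3]$ by $\alpha(R_{\{x_i=n\}}(x))=R_{\{x_i=3n\}}(\alpha(x))$, $i\in\{1,2\}$, $n$ odd. On $E=A(1,e^{1/d})\setminus\mathcal{Z}(\frac1dF)$ put $g(x)=(\mathcal{Z}\circ\alpha)(d\,\mathcal{Z}^{-1}(x))$ (well defined). Let $\mu(x)=(1,0,0)+2(x_1-1,x_2,x_3)/|(x_1-1,x_2,x_3)|^2$; let $\nu$ on $\{x_1>0\}$ be the identity where $x_1\ge|x_3|$ and $\nu(\rho\cos\phi,x_2,\rho\sin\phi)=(\rho\cos\phi',x_2,\rho\sin\phi')$ with $\phi'=3(\phi\mp\frac\pi4)\pm\frac\pi4$ for $\frac\pi4<\pm\phi<\frac\pi2$; and let $\beta=\mu\circ\nu\circ\mu$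 on $\{|x|>1\}$, extended continuously to $\{|x|=1\}$. Let $X=(B((0,0,1),\sqrt2)\cup B((0,0,-1),\sqrt2))\setminus B(0,1)$ and let $W$ be the union of those components of $g^{-1}(X)$ that neighbour the flaps $\mathcal{Z}(\frac1dF)$, i.e. that do not meet the unit sphere. Then $P=\beta\circ g$ on $W$, $P=g$ on $E\setminus W$, and $P$ is extended continuously to $A(1,e^{1/d})$; $P$ is quasiregular with dilatation bounded independently of $d$, $P=p_d$ on $\{|x|=1\}$, and $P=p_{3d}$ on $\{|x|=e^{1/d}\}$. For $R>0$, odd $d$ and $c>0$, let $c'=cR^{-2d}$ and $F_{R,d,c}(x)=c'R^{3d}P(x/R)$ on $A(R,Re^{1/d})$; it equals $c\,p_d$ on $\{|x|=R\}$ and $c'p_{3d}$ on $\{|x|=Re^{1/d}\}$. Construction of $f$ from $(\lambda_n)$. Let $d_n=3^n$, $R_1=1$, $S_1=e^{1/3}$, and for $n\ge1$, $R_{n+1}=\lambda_nS_n$, $S_{n+1}=e^{1/d_{n+1}}R_{n+1}$. Let $C_1=1$ and $C_{n+1}=C_nR_{n+1}^{-2d_{n+1}}$. Set $f=p_3$ on $\overline{B(0,R_1)}$; $f=F_{R_1,3,1}$ on $A(R_1,S_1)$; $f=C_1p_9$ on $A(S_1,R_2)$; and for $n\ge1$, $f=F_{R_{n+1},d_{n+1},C_n}$ on $A(R_{n+1},S_{n+1})$ and $f=C_{n+1}p_{d_{n+2}}$ on $A(S_{n+1},R_{n+2})$. When $\prod_{j=1}^n\lambda_j\to\infty$ this defines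 a quasiregular map on all of $\mathbb{R}^3$. *)

theory Defs
  imports "HOL-Analysis.Analysis"
begin

abbreviation vec3 :: "real \<Rightarrow> real \<Rightarrow> real \<Rightarrow> real^3" where
  "vec3 a b c \<equiv> vector [a, b, c]"

abbreviation annulus :: "real \<Rightarrow> real \<Rightarrow> (real^3) set" where
  "annulus r s \<equiv> {x. r \<le> norm x \<and> norm x \<le> s}"

(* reflection in the plane {x. a \<bullet> x = b} *)
definition plane_reflection :: "real^3 \<Rightarrow> real \<Rightarrow> real^3 \<Rightarrow> real^3" where
  "plane_reflection a b x = x - (2 * (a \<bullet> x - b) / (a \<bullet> a)) *\<^sub>R a"

(* reflection in the coordinate plane {x. x $ i = b} *)
abbreviation coord_reflection :: "3 \<Rightarrow> real \<Rightarrow> real^3 \<Rightarrow> real^3" where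
  "coord_reflection i b \<equiv> plane_reflection (axis i 1) b"

(* Extension of a map \<phi>, given on D, to the orbit of D by the rules
   f (\<rho> x) = \<sigma> (f x) for (\<rho>, \<sigma>) \<in> G. *)
inductive equivariant_graph ::
  "(('a \<Rightarrow> 'a) \<times> ('b \<Rightarrow> 'b)) set \<Rightarrow> 'a set \<Rightarrow> ('a \<Rightarrow> 'b) \<Rightarrow> 'a \<Rightarrow> 'b \<Rightarrow> bool"
  for G D \<phi> where
  base: "x \<in> D \<Longrightarrow> equivariant_graph G D \<phi> x (\<phi> x)"
| step: "equivariant_graph G D \<phi> x y \<Longrightarrow> (\<rho>, \<sigma>) \<in> G \<Longrightarrow> equivariant_graph G D \<phi> (\<rho> x) (\<sigma> y)"

definition equivariant_extension ::
  "(('a \<Rightarrow> 'a) \<times> ('b \<Rightarrow> 'b)) set \<Rightarrow> 'a set \<Rightarrow> ('a \<Rightarrow> 'b) \<Rightarrow> 'a \<Rightarrow> 'b" where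
  "equivariant_extension G D \<phi> x = (THE y. equivariant_graph G D \<phi> x y)"


subsection \<open>Zorich and power maps\<close>

definition unit_square :: "(real^2) set" where
  "unit_square = {u. \<bar>u $ 1\<bar> \<le> 1 \<and> \<bar>u $ 2\<bar> \<le> 1}"

definition upper_hemisphere :: "(real^3) set" where
  "upper_hemisphere = {y. norm y = 1 \<and> 0 \<le> y $ 3}"

definition bilipschitz_on :: "'a::metric_space set \<Rightarrow> ('a \<Rightarrow> 'b::metric_space) \<Rightarrow> bool" where
  "bilipschitz_on A f \<longleftrightarrow>
     (\<exists>L>0. \<forall>u\<in>A. \<forall>v\<in>A. dist u v / L \<le> dist (f u) (f v) \<and> dist (f u) (f v) \<le> L * dist u v)"

(* Stated through the sign of the Jacobian; the Zorich map of a bi-Lipschitz h is locally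
   Lipschitz, hence differentiable almost everywhere. *)
definition orientation_preserving :: "(real^3 \<Rightarrow> real^3) \<Rightarrow> bool" where
  "orientation_preserving f \<longleftrightarrow>
     (AE x in lebesgue. \<exists>f'. (f has_derivative f') (at x) \<and> 0 < det (matrix f'))"

definition zorich :: "(real^2 \<Rightarrow> real^3) \<Rightarrow> real^3 \<Rightarrow> real^3" where
  "zorich h = equivariant_extension
     {(coord_reflection i (of_int n), coord_reflection 3 0) | i n. i \<in> {1, 2} \<and> odd n}
     {x. \<bar>x $ 1\<bar> \<le> 1 \<and> \<bar>x $ 2\<bar> \<le> 1}
     (\<lambda>x. exp (x $ 3) *\<^sub>R h (vector [x $ 1, x $ 2]))"

(* For odd d. As zorich h maps onto the complement of 0, the functional equation together with
   the value at 0 determines the map. *)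
definition power_map :: "(real^2 \<Rightarrow> real^3) \<Rightarrow> nat \<Rightarrow> real^3 \<Rightarrow> real^3" where
  "power_map h d = (THE p. p 0 = 0 \<and> (\<forall>x. p (zorich h x) = zorich h (real d *\<^sub>R x)))"


subsection \<open>The interpolating map\<close>

definition Delta1 :: "(real^3) set" where
  "Delta1 = convex hull {vec3 0 0 1, vec3 0 0 0, vec3 1 1 0, vec3 0 1 0}"

definition Delta2 :: "(real^3) set" where
  "Delta2 = convex hull {vec3 0 0 1, vec3 0 1 0, vec3 1 1 0, vec3 0 1 (1/2)}"

definition Delta3 :: "(real^3) set" where
  "Delta3 = convex hull {vec3 0 0 1, vec3 1 1 0, vec3 0 1 (1/2), vec3 1 1 (1/2)}"

definition Delta4 :: "(real^3) set" where
  "Delta4 = convex hull {vec3 0 0 1, vec3 0 1 (1/2), vec3 1 1 (1/2), vec3 0 1 1}"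

definition Delta5 :: "(real^3) set" where
  "Delta5 = convex hull {vec3 0 0 1, vec3 0 1 1, vec3 1 1 (1/2), vec3 1 1 1}"

(* The affine pieces agree on common faces, so the order of the cases is immaterial; the last
   case is Delta4 \<union> Delta5, since the five simplices cover the prism
   0 \<le> x1 \<le> x2 \<le> 1, 0 \<le> x3 \<le> 1. *)
definition alpha_prism :: "real^3 \<Rightarrow> real^3" where
  "alpha_prism x =
     (if x \<in> Delta1 then vec3 (x $ 1) (x $ 2) (3 * x $ 3)
      else if x \<in> Delta2 then vec3 (x $ 1) (5 * x $ 2 + 4 * x $ 3 - 4) (3 - 3 * x $ 2)
      else if x \<in> Delta3 then
        vec3 (3 * x $ 1 + 2 * x $ 2 + 4 * x $ 3 - 4) (5 * x $ 2 + 4 * x $ 3 - 4) (3 - 3 * x $ 2)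
      else vec3 (3 * x $ 1) (3 * x $ 2) (6 * x $ 3 - 3))"

definition alpha' :: "real^3 \<Rightarrow> real^3" where
  "alpha' = equivariant_extension
     {(plane_reflection a 0, plane_reflection a 0) | a.
        a \<in> {vec3 1 0 0, vec3 0 1 0, vec3 1 (-1) 0, vec3 1 1 0}}
     (Delta1 \<union> Delta2 \<union> Delta3 \<union> Delta4 \<union> Delta5)
     alpha_prism"

definition flap_set :: "(real^3) set" where
  "flap_set = {x. (\<exists>i::int. x $ 2 = 2 * of_int i - 1) \<and> 0 \<le> x $ 3 \<and> x $ 3 < 1/2}
            \<union> {x. (\<exists>j::int. x $ 1 = 2 * of_int j - 1) \<and> 0 \<le> x $ 3 \<and> x $ 3 < 1/2}"

(* relevant on (R^2 x [0,1]) - flap_set *)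
definition alpha :: "real^3 \<Rightarrow> real^3" where
  "alpha = equivariant_extension
     {(coord_reflection i (of_int n), coord_reflection i (3 * of_int n)) | i n.
        i \<in> {1, 2} \<and> odd n}
     ({x. \<bar>x $ 1\<bar> \<le> 1 \<and> \<bar>x $ 2\<bar> \<le> 1 \<and> 0 \<le> x $ 3 \<and> x $ 3 \<le> 1} - flap_set)
     alpha'"

definition interp_dom :: "(real^2 \<Rightarrow> real^3) \<Rightarrow> nat \<Rightarrow> (real^3) set" where
  "interp_dom h d =
     annulus 1 (exp (1 / real d)) - (\<lambda>y. zorich h ((1 / real d) *\<^sub>R y)) ` flap_set"

(* independent of the preimage chosen by inv *)
definition interp_g :: "(real^2 \<Rightarrow> real^3) \<Rightarrow> nat \<Rightarrow> real^3 \<Rightarrow> real^3" where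
  "interp_g h d x = zorich h (alpha (real d *\<^sub>R inv (zorich h) x))"

definition mu :: "real^3 \<Rightarrow> real^3" where
  "mu x = vec3 1 0 0 + (2 / (norm (x - vec3 1 0 0))\<^sup>2) *\<^sub>R (x - vec3 1 0 0)"

(* for x $ 1 > 0, so that arctan gives the polar angle in the (x1, x3)-plane *)
definition nu :: "real^3 \<Rightarrow> real^3" where
  "nu x =
     (if \<bar>x $ 3\<bar> \<le> x $ 1 then x
      else let \<rho> = sqrt ((x $ 1)\<^sup>2 + (x $ 3)\<^sup>2);
               \<phi> = arctan (x $ 3 / x $ 1);
               \<phi>' = (if 0 < \<phi> then 3 * (\<phi> - pi/4) + pi/4 else 3 * (\<phi> + pi/4) - pi/4)
           in vec3 (\<rho> * cos \<phi>') (x $ 2) (\<rho> * sin \<phi>'))"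

(* for norm x \<ge> 1 *)
definition beta :: "real^3 \<Rightarrow> real^3" where
  "beta x = (if 1 < norm x then mu (nu (mu x))
             else Lim (at x within {y. 1 < norm y}) (\<lambda>y. mu (nu (mu y))))"

definition lens_region :: "(real^3) set" where
  "lens_region = (ball (vec3 0 0 1) (sqrt 2) \<union> ball (vec3 0 0 (-1)) (sqrt 2)) - ball 0 1"

definition interp_W :: "(real^2 \<Rightarrow> real^3) \<Rightarrow> nat \<Rightarrow> (real^3) set" where
  "interp_W h d =
     \<Union>{K \<in> components {x \<in> interp_dom h d. interp_g h d x \<in> lens_region}. K \<inter> sphere 0 1 = {}}"

definition interp_P0 :: "(real^2 \<Rightarrow> real^3) \<Rightarrow> nat \<Rightarrow> real^3 \<Rightarrow> real^3" where
  "interp_P0 h d x = (if x \<in> interp_W h d then beta (interp_g h d x) else interp_g h d x)"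

(* for x \<in> annulus 1 (exp (1/d)): continuous extension across the flaps *)
definition interp_P :: "(real^2 \<Rightarrow> real^3) \<Rightarrow> nat \<Rightarrow> real^3 \<Rightarrow> real^3" where
  "interp_P h d x = (if x \<in> interp_dom h d then interp_P0 h d x
                     else Lim (at x within interp_dom h d) (interp_P0 h d))"

definition interp_F :: "(real^2 \<Rightarrow> real^3) \<Rightarrow> real \<Rightarrow> nat \<Rightarrow> real \<Rightarrow> real^3 \<Rightarrow> real^3" where
  "interp_F h R d c x =
     (let c' = c / R ^ (2 * d) in (c' * R ^ (3 * d)) *\<^sub>R interp_P h d ((1 / R) *\<^sub>R x))"


subsection \<open>The map built from a sequence\<close>

(* The sequences R_n and S_n start at n = 1; the values at 0 are not used. *)
fun inner_radius :: "(nat \<Rightarrow> real) \<Rightarrow> nat \<Rightarrow> real" where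
  "inner_radius lam 0 = 1"
| "inner_radius lam (Suc 0) = 1"
| "inner_radius lam (Suc (Suc n)) =
     lam (Suc n) * (exp (1 / 3 ^ Suc n) * inner_radius lam (Suc n))"

definition outer_radius :: "(nat \<Rightarrow> real) \<Rightarrow> nat \<Rightarrow> real" where
  "outer_radius lam n = exp (1 / 3 ^ n) * inner_radius lam n"

(* Starting with C_0 = 1 gives C_1 = 1, as R_1 = 1, and lets the annulus R_1 \<le> |x| \<le> S_1 be
   treated like the later ones. *)
primrec coef :: "(nat \<Rightarrow> real) \<Rightarrow> nat \<Rightarrow> real" where
  "coef lam 0 = 1"
| "coef lam (Suc n) = coef lam n / inner_radius lam (Suc n) ^ (2 * 3 ^ Suc n)"

(* Adjacent pieces agree on their common sphere; there the power map is used. For lam \<ge> 1 at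
   most one n is eligible in each of the two descriptions. *)
definition constructed_map :: "(real^2 \<Rightarrow> real^3) \<Rightarrow> (nat \<Rightarrow> real) \<Rightarrow> real^3 \<Rightarrow> real^3" where
  "constructed_map h lam x =
     (let R = inner_radius lam; S = outer_radius lam; C = coef lam in
      if norm x \<le> R 1 then power_map h 3 x
      else if \<exists>n\<ge>1. x \<in> annulus (S n) (R (n + 1)) then
        (let n = (THE n. 1 \<le> n \<and> x \<in> annulus (S n) (R (n + 1)))
         in C n *\<^sub>R power_map h (3 ^ (n + 1)) x)
      else
        (let n = (THE n. 1 \<le> n \<and> x \<in> annulus (R n) (S n))
         in interp_F h (R n) (3 ^ n) (C (n - 1)) x))"

(* The supremum is attained when f is continuous. *)
definition max_modulus :: "real \<Rightarrow> (real^3 \<Rightarrow> real^3) \<Rightarrow> real" where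
  "max_modulus r f = (SUP x\<in>sphere 0 r. norm (f x))"

end

theory Submission
  imports Defs "HOL-Real_Asymp.Real_Asymp"
begin

text \<open>
  Only the spheres \<open>|x| = R\<^sub>n\<^sub>+\<^sub>1\<close> are needed: there the map is \<open>C\<^sub>n p\<^sub>d\<close> with \<open>d = 3\<^sup>n\<^sup>+\<^sup>1\<close>, and
  the recursion for \<open>R\<^sub>n\<close> and \<open>C\<^sub>n\<close> makes the logarithm of the maximum modulus equal to the sum
  of \<open>3 + 3\<^sup>j\<^sup>+\<^sup>1 ln \<lambda>\<^sub>j\<close> over \<open>1 \<le> j \<le> n\<close>. For fast growth, let \<open>\<lambda>\<^sub>j\<close> be 1 except at very sparse
  indices, where it is a fixed constant: the radii then grow slowly, but each jump is amplified by
  \<open>3\<^sup>j\<^sup>+\<^sup>1\<close>. For slow growth, \<open>|C\<^sub>n| \<le> 1\<close> bounds the logarithm by \<open>3\<^sup>n\<^sup>+\<^sup>1 ln R\<^sub>n\<^sub>+\<^sub>1\<close>, and \<open>R\<^sub>n\<^sub>+\<^sub>1\<close> may be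
  as large as desired. That \<open>|p\<^sub>d(x)| = |x|\<^sup>d\<close> depends on the Zorich map being well defined with
  the expected fibres, which holds since, by invariance of domain, \<open>h\<close> maps exactly the boundary
  of the square to the equator.
\<close>

section \<open>The Zorich map\<close>

lemma coord_reflection_component:
  "coord_reflection i b x $ j = (if j = i then 2 * b - x $ i else x $ j)"
  by (simp add: plane_reflection_def inner_axis') (simp add: axis_def)

abbreviation flip3 :: "real^3 \<Rightarrow> real^3" where
  "flip3 \<equiv> coord_reflection 3 0"

lemma flip3_flip3 [simp]: "flip3 (flip3 y) = y"
  by (simp add: vec_eq_iff coord_reflection_component)

lemma flip3_eq_iff: "flip3 y = z \<longleftrightarrow> y = flip3 z"
  by auto

lemma norm_flip3 [simp]: "norm (flip3 y) = norm y"
  by (simp add: norm_eq_sqrt_inner inner_vec_def sum_3 coord_reflection_component)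

lemma flip3_scaleR: "flip3 (c *\<^sub>R y) = c *\<^sub>R flip3 y"
  by (simp add: vec_eq_iff coord_reflection_component)

section \<open>Folding the real line onto [-1,1]\<close>

definition parity_sign :: "int \<Rightarrow> real" where
  "parity_sign n = (if even n then 1 else -1)"

text \<open>The coordinate in \<open>[-1,1]\<close> obtained by folding the interval \<open>[2n-1, 2n+1]\<close>.\<close>

definition fold_coord :: "int \<Rightarrow> real \<Rightarrow> real" where
  "fold_coord n t = parity_sign n * (t - 2 * of_int n)"

lemma fold_coord_bounds: "\<bar>t - 2 * of_int n\<bar> \<le> 1 \<Longrightarrow> \<bar>fold_coord n t\<bar> \<le> 1"
  by (auto simp: fold_coord_def parity_sign_def abs_minus_commute)

lemma ex_cell:
  fixes t :: real
  shows "\<exists>n::int. \<bar>t - 2 * of_int n\<bar> \<le> 1"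
proof
  define n where "n = \<lfloor>(t + 1) / 2\<rfloor>"
  have "of_int n \<le> (t + 1) / 2" "(t + 1) / 2 < of_int n + 1"
    unfolding n_def by linarith+
  then show "\<bar>t - 2 * of_int n\<bar> \<le> 1"
    by (simp add: abs_le_iff field_simps)
qed

text \<open>A coordinate lying in two cells is their common end point.\<close>

lemma two_cells:
  fixes t :: real
  assumes "\<bar>t - 2 * of_int n\<bar> \<le> 1" "\<bar>t - 2 * of_int m\<bar> \<le> 1" "n \<noteq> m"
  shows "\<bar>fold_coord n t\<bar> = 1" "fold_coord n t = fold_coord m t" "odd (n + m)"
proof -
  have "\<bar>real_of_int n - of_int m\<bar> \<le> 1"
    using assms(1,2) by linarith
  then have "\<bar>n - m\<bar> \<le> 1"
    by linarith
  then consider "n = m + 1" | "m = n + 1"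
    using assms(3) by linarith
  then have "\<bar>fold_coord n t\<bar> = 1 \<and> fold_coord n t = fold_coord m t \<and> odd (n + m)"
  proof cases
    case 1
    then have "t = 2 * of_int m + 1" using assms(1,2) by simp
    then show ?thesis using 1 by (simp add: fold_coord_def parity_sign_def)
  next
    case 2
    then have "t = 2 * of_int n + 1" using assms(1,2) by simp
    then show ?thesis using 2 by (simp add: fold_coord_def parity_sign_def)
  qed
  then show "\<bar>fold_coord n t\<bar> = 1" "fold_coord n t = fold_coord m t" "odd (n + m)"
    by auto
qed

text \<open>Converse to \<open>two_cells\<close>: a coordinate folded to an end point lies on the
  border of its cell, and the cell across that border folds it to the same point.\<close>

lemma neighbour_cell:
  assumes "\<bar>fold_coord n t\<bar> = 1"
  obtains m where "\<bar>t - 2 * of_int m\<bar> \<le> 1" "fold_coord m t = fold_coord n t" "odd (n + m)"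
proof -
  have "t = 2 * of_int n + 1 \<or> t = 2 * of_int n - 1"
    using assms by (auto simp: fold_coord_def parity_sign_def abs_if split: if_splits)
  then show thesis
  proof
    assume "t = 2 * of_int n + 1"
    then show thesis
      by (intro that[of "n + 1"]) (auto simp: fold_coord_def parity_sign_def)
  next
    assume "t = 2 * of_int n - 1"
    then show thesis
      by (intro that[of "n - 1"]) (auto simp: fold_coord_def parity_sign_def)
  qed
qed

text \<open>Two signs cancel: the reflection reverses the coordinate, and \<open>n\<close> and
  \<open>k - n\<close> have opposite parity.\<close>

lemma fold_coord_reflect:
  "odd k \<Longrightarrow> fold_coord n (2 * of_int k - t) = fold_coord (k - n) t"
  by (simp add: fold_coord_def parity_sign_def algebra_simps)

text \<open>With s the sign of cell \<open>n\<close>, t = 2n + s u and so d t = 2 d n + s d u: the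
  index \<open>a\<close> for d u is shifted by d n and negated for odd \<open>n\<close>. As
  \<open>d\<close> is odd, the new index has the parity of n + a, which gives the right
  sign.\<close>

lemma fold_coord_odd_multiple:
  assumes "odd d" "fold_coord n t = u" "fold_coord a (real d * u) = w"
  shows "fold_coord (int d * n + (if even n then a else - a)) (real d * t) = w"
  unfolding assms(2,3)[symmetric] fold_coord_def parity_sign_def
  using assms(1) by (auto simp: algebra_simps)

section \<open>Square, hemisphere and disc\<close>

lemma unit_square_eq_cbox: "unit_square = cbox (vector [-1, -1]) (vector [1, 1])"
  by (auto simp: unit_square_def mem_box_cart forall_2 abs_le_iff)

lemma interior_unit_square: "interior unit_square = {u. \<bar>u $ 1\<bar> < 1 \<and> \<bar>u $ 2\<bar> < 1}"
  by (auto simp: unit_square_eq_cbox interior_cbox mem_box_cart forall_2)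

text \<open>Flattens the hemisphere to the closed unit disc, so that invariance of domain can be
  applied within the plane.\<close>

definition equatorial_proj :: "real^3 \<Rightarrow> real^2" where
  "equatorial_proj y = vector [y $ 1, y $ 2]"

lemma norm_equatorial_proj: "(norm (equatorial_proj y))\<^sup>2 = (norm y)\<^sup>2 - (y $ 3)\<^sup>2"
  unfolding equatorial_proj_def power2_norm_eq_inner
  by (simp add: inner_vec_def sum_2 sum_3 power2_eq_square)

lemma continuous_on_equatorial_proj: "continuous_on S equatorial_proj"
proof -
  have "linear equatorial_proj"
    by (intro linearI) (simp_all add: equatorial_proj_def vec_eq_iff forall_2)
  then show ?thesis
    by (simp add: linear_continuous_on linear_conv_bounded_linear)
qed

lemma inj_on_equatorial_proj: "inj_on equatorial_proj upper_hemisphere"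
proof (rule inj_onI)
  fix y z :: "real^3"
  assume yz: "y \<in> upper_hemisphere" "z \<in> upper_hemisphere" "equatorial_proj y = equatorial_proj z"
  then have "(y $ 3)\<^sup>2 = (z $ 3)\<^sup>2"
    using norm_equatorial_proj[of y] norm_equatorial_proj[of z] by (simp add: upper_hemisphere_def)
  then have "y $ 3 = z $ 3"
    using yz by (simp add: upper_hemisphere_def)
  moreover have "y $ 1 = z $ 1" "y $ 2 = z $ 2"
    using yz(3) by (auto simp: equatorial_proj_def vec_eq_iff forall_2)
  ultimately show "y = z"
    by (simp add: vec_eq_iff forall_3)
qed

lemma equatorial_proj_hemisphere: "equatorial_proj ` upper_hemisphere = cball 0 1"
proof (intro equalityI subsetI)
  fix u assume "u \<in> equatorial_proj ` upper_hemisphere"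
  then obtain y where y: "norm y = 1" "u = equatorial_proj y"
    by (auto simp: upper_hemisphere_def)
  then have "(norm u)\<^sup>2 \<le> 1"
    using norm_equatorial_proj[of y] by simp
  then show "u \<in> cball 0 1"
    by (simp add: power_le_one_iff)
next
  fix u :: "real^2" assume "u \<in> cball 0 1"
  then have u: "(norm u)\<^sup>2 \<le> 1"
    by (simp add: power_le_one_iff)
  define y where "y = vec3 (u $ 1) (u $ 2) (sqrt (1 - (norm u)\<^sup>2))"
  have eq: "equatorial_proj y = u"
    by (simp add: y_def equatorial_proj_def vec_eq_iff forall_2)
  have "(norm y)\<^sup>2 = 1"
    using norm_equatorial_proj[of y] u unfolding eq by (simp add: y_def)
  then have "norm y = 1"
    by (metis norm_ge_zero one_power2 power2_eq_imp_eq zero_le_one)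
  then have "y \<in> upper_hemisphere"
    using u by (simp add: upper_hemisphere_def y_def)
  then show "u \<in> equatorial_proj ` upper_hemisphere"
    using eq by force
qed

section \<open>The Zorich map, cell by cell\<close>

locale zorich_base =
  fixes h :: "real^2 \<Rightarrow> real^3"
  assumes bilip: "bilipschitz_on unit_square h"
    and image: "h ` unit_square = upper_hemisphere"
begin

lemma continuous_on_h: "continuous_on unit_square h"
proof -
  obtain L where "L > 0" "\<forall>u\<in>unit_square. \<forall>v\<in>unit_square. dist (h u) (h v) \<le> L * dist u v"
    using bilip unfolding bilipschitz_on_def by blast
  then have "L-lipschitz_on unit_square h"
    by (auto simp: lipschitz_on_def)
  then show ?thesis
    by (rule lipschitz_on_continuous_on)
qed

lemma inj_on_h: "inj_on h unit_square"
proof (rule inj_onI)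
  fix u v assume uv: "u \<in> unit_square" "v \<in> unit_square" "h u = h v"
  obtain L where "L > 0" "\<forall>u\<in>unit_square. \<forall>v\<in>unit_square. dist u v / L \<le> dist (h u) (h v)"
    using bilip unfolding bilipschitz_on_def by blast
  then have "L > 0" "dist u v / L \<le> 0"
    using uv by force+
  then show "u = v"
    by (simp add: divide_le_0_iff)
qed

lemma h_hemisphere: "u \<in> unit_square \<Longrightarrow> norm (h u) = 1 \<and> 0 \<le> h u $ 3"
  using image by (auto simp: upper_hemisphere_def)

text \<open>Followed by \<open>equatorial_proj\<close>, \<open>h\<close> is a homeomorphism of the
  square onto the closed disc. Invariance of domain for this map and its inverse matches the
  interiors, hence the boundaries, and the unit circle is the image of the equator.\<close>

lemma equator_iff_boundary:
  assumes u: "u \<in> unit_square"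
  shows "h u $ 3 = 0 \<longleftrightarrow> \<bar>u $ 1\<bar> = 1 \<or> \<bar>u $ 2\<bar> = 1"
proof -
  define f where "f = equatorial_proj \<circ> h"
  have cont: "continuous_on unit_square f"
    unfolding f_def by (intro continuous_on_compose continuous_on_h continuous_on_equatorial_proj)
  have inj: "inj_on f unit_square"
    unfolding f_def by (intro comp_inj_on inj_on_h) (simp add: image inj_on_equatorial_proj)
  have img: "f ` unit_square = cball 0 1"
    unfolding f_def by (simp only: image_comp[symmetric] image equatorial_proj_hemisphere)
  have "open (f ` interior unit_square)"
    using cont inj by (intro invariance_of_domain continuous_on_subset[OF cont] inj_on_subset[OF inj])
      (auto simp: interior_subset)
  moreover have "f ` interior unit_square \<subseteq> cball 0 1"
    using img interior_subset by blast
  ultimately have "f ` interior unit_square \<subseteq> interior (cball 0 1)"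
    by (intro interior_maximal)
  then have 1: "u \<in> interior unit_square \<Longrightarrow> f u \<in> ball 0 1"
    by auto
  define g where "g = inv_into unit_square f"
  have gf: "g (f v) = v" if "v \<in> unit_square" for v
    using inj that by (simp add: g_def)
  \<comment> \<open>The inverse is continuous because the square is compact.\<close>
  have gcont: "continuous_on (cball 0 1) g"
    using continuous_on_inv[OF cont _ ballI[of unit_square "\<lambda>v. g (f v) = v"]] gf img
    by (simp add: unit_square_eq_cbox)
  have ginj: "inj_on g (cball 0 1)"
    unfolding g_def img[symmetric] by (simp add: inj_on_inv_into)
  have "open (g ` ball 0 1)"
    by (intro invariance_of_domain continuous_on_subset[OF gcont] inj_on_subset[OF ginj]) auto
  moreover have "g ` ball 0 1 \<subseteq> unit_square"
  proof -
    have "g ` cball 0 1 \<subseteq> unit_square"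
      using gf unfolding img[symmetric] by auto
    then show ?thesis
      using ball_subset_cball by blast
  qed
  ultimately have "g ` ball 0 1 \<subseteq> interior unit_square"
    by (simp add: interior_maximal)
  then have 2: "f u \<in> ball 0 1 \<Longrightarrow> u \<in> interior unit_square"
    using gf[OF u] by (metis image_subset_iff)
  have "(norm (f u))\<^sup>2 = 1 - (h u $ 3)\<^sup>2"
    using norm_equatorial_proj[of "h u"] h_hemisphere[OF u] by (simp add: f_def)
  then have "h u $ 3 = 0 \<longleftrightarrow> (norm (f u))\<^sup>2 = 1"
    by simp
  then have "h u $ 3 = 0 \<longleftrightarrow> norm (f u) = 1"
    unfolding power2_eq_1_iff by (smt (verit) norm_ge_zero)
  moreover have "norm (f u) \<le> 1"
    using img u by auto
  ultimately have "h u $ 3 = 0 \<longleftrightarrow> f u \<notin> ball 0 1"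
    by auto
  also have "\<dots> \<longleftrightarrow> u \<notin> interior unit_square"
    using 1 2 by blast
  also have "\<dots> \<longleftrightarrow> \<bar>u $ 1\<bar> = 1 \<or> \<bar>u $ 2\<bar> = 1"
    using u unfolding interior_unit_square by (auto simp: unit_square_def)
  finally show ?thesis .
qed

text \<open>Closed form of the Zorich map on the cell around (2n, 2m): each wall crossed contributes
  one \<open>flip3\<close>, so only the parity of n + m remains.\<close>

definition cell_value :: "int \<Rightarrow> int \<Rightarrow> real^3 \<Rightarrow> real^3" where
  "cell_value n m x =
     exp (x $ 3) *\<^sub>R (if even (n + m) then id else flip3)
       (h (vector [fold_coord n (x $ 1), fold_coord m (x $ 2)]))"

abbreviation in_cell :: "int \<Rightarrow> int \<Rightarrow> real^3 \<Rightarrow> bool" where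
  "in_cell n m x \<equiv> \<bar>x $ 1 - 2 * of_int n\<bar> \<le> 1 \<and> \<bar>x $ 2 - 2 * of_int m\<bar> \<le> 1"

lemma fold_in_square:
  "in_cell n m x \<Longrightarrow> vector [fold_coord n (x $ 1), fold_coord m (x $ 2)] \<in> unit_square"
  by (simp add: unit_square_def fold_coord_bounds)

text \<open>The two formulas differ at most by a \<open>flip3\<close>. In that case the point is on
  a wall, so it folds to the boundary of the square, and \<open>h\<close> sends it to the equator,
  which \<open>flip3\<close> fixes.\<close>

lemma cell_value_unique:
  assumes "in_cell n m x" "in_cell n' m' x"
  shows "cell_value n m x = cell_value n' m' x"
proof -
  define u :: "real^2" where "u = vector [fold_coord n (x $ 1), fold_coord m (x $ 2)]"
  have u: "u \<in> unit_square"
    unfolding u_def using assms(1) by (rule fold_in_square)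
  have eq: "fold_coord n' (x $ 1) = fold_coord n (x $ 1)" "fold_coord m' (x $ 2) = fold_coord m (x $ 2)"
    using two_cells(2) assms by metis+
  have "flip3 (h u) = h u" if "\<not> (even (n + m) \<longleftrightarrow> even (n' + m'))"
  proof -
    have "n \<noteq> n' \<or> m \<noteq> m'"
      using that by auto
    then have "\<bar>fold_coord n (x $ 1)\<bar> = 1 \<or> \<bar>fold_coord m (x $ 2)\<bar> = 1"
      using two_cells(1) assms by metis
    then have "h u $ 3 = 0"
      using equator_iff_boundary[OF u] by (simp add: u_def)
    then show ?thesis
      by (simp add: vec_eq_iff coord_reflection_component)
  qed
  then show ?thesis
    unfolding cell_value_def eq u_def[symmetric] by auto
qed

abbreviation zorich_graph :: "real^3 \<Rightarrow> real^3 \<Rightarrow> bool" where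
  "zorich_graph \<equiv> equivariant_graph
     {(coord_reflection i (of_int n), coord_reflection 3 0) | i n. i \<in> {1, 2} \<and> odd n}
     {x. \<bar>x $ 1\<bar> \<le> 1 \<and> \<bar>x $ 2\<bar> \<le> 1}
     (\<lambda>x. exp (x $ 3) *\<^sub>R h (vector [x $ 1, x $ 2]))"

text \<open>Uniqueness of the value, by induction along the reflections. The cell stays arbitrary
  because reflecting at an odd \<open>k\<close> exchanges the indices \<open>n\<close> and
  \<open>k - n\<close>; the change of parity accounts for the \<open>flip3\<close>.\<close>

lemma zorich_graph_cell_value:
  "zorich_graph x y \<Longrightarrow> in_cell n m x \<Longrightarrow> y = cell_value n m x"
proof (induction arbitrary: n m rule: equivariant_graph.induct)
  case (base x)
  \<comment> \<open>A point on the border of the central square also lies in other cells.\<close>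
  then have "cell_value n m x = cell_value 0 0 x"
    by (intro cell_value_unique) auto
  then show ?case
    by (simp add: cell_value_def fold_coord_def parity_sign_def)
next
  case (step x y \<rho> \<sigma>)
  then obtain i k where ik: "\<rho> = coord_reflection i (of_int k)" "\<sigma> = flip3" "i = 1 \<or> i = 2" "odd k"
    by auto
  from ik(3) show ?case
  proof
    assume i: "i = 1"
    then have "in_cell (k - n) m x"
      using step.prems by (auto simp: ik coord_reflection_component abs_le_iff)
    then have "y = cell_value (k - n) m x"
      by (rule step.IH)
    then show ?thesis
      using ik by (simp add: cell_value_def i coord_reflection_component fold_coord_reflect flip3_scaleR)
  next
    assume i: "i = 2"
    then have "in_cell n (k - m) x"
      using step.prems by (auto simp: ik coord_reflection_component abs_le_iff)
    then have "y = cell_value n (k - m) x"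
      by (rule step.IH)
    then show ?thesis
      using ik by (simp add: cell_value_def i coord_reflection_component fold_coord_reflect flip3_scaleR)
  qed
qed

lemma zorich_graph_total: "\<exists>y. zorich_graph x y"
proof -
  define Q where "Q x \<longleftrightarrow> (\<exists>y. zorich_graph x y)" for x
  \<comment> \<open>Reflections are involutions, so the rule \<open>step\<close> can also be used
    backwards.\<close>
  have reflect: "Q x" if "Q (coord_reflection i (of_int k) x)" "i \<in> {1, 2}" "odd k" for i k x
  proof -
    from that(1) obtain y where "zorich_graph (coord_reflection i (of_int k) x) y"
      unfolding Q_def by blast
    then have "zorich_graph (coord_reflection i (of_int k) (coord_reflection i (of_int k) x)) (flip3 y)"
      by (rule equivariant_graph.step) (use that in auto)
    moreover have "coord_reflection i (of_int k) (coord_reflection i (of_int k) x) = x"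
      by (simp add: vec_eq_iff coord_reflection_component)
    ultimately show ?thesis
      unfolding Q_def by metis
  qed
  have central: "Q x" if "in_cell 0 0 x" for x
    unfolding Q_def by (rule exI, rule equivariant_graph.base) (use that in simp)
  text \<open>A cell with odd index is reached from the cell with index 0 by one reflection; one further
    reflection, in the plane at 1, reaches the cells with even index.\<close>
  have row_odd: "Q x" if "in_cell n 0 x" "odd n" for n x
  proof (rule reflect[of 1 n])
    show "Q (coord_reflection 1 (of_int n) x)"
      by (rule central) (use that in \<open>auto simp: coord_reflection_component abs_le_iff\<close>)
  qed (use that in auto)
  have row: "Q x" if "in_cell n 0 x" for n x
  proof (cases "odd n")
    case False
    show ?thesis
    proof (rule reflect[of 1 1])
      show "Q (coord_reflection 1 (of_int 1) x)"
        by (rule row_odd[where n = "1 - n"])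
          (use that False in \<open>auto simp: coord_reflection_component abs_le_iff\<close>)
    qed auto
  qed (use row_odd that in blast)
  have column_odd: "Q x" if "in_cell n m x" "odd m" for n m x
  proof (rule reflect[of 2 m])
    show "Q (coord_reflection 2 (of_int m) x)"
      by (rule row[where n = n]) (use that in \<open>auto simp: coord_reflection_component abs_le_iff\<close>)
  qed (use that in auto)
  have "Q x" if "in_cell n m x" for n m x
  proof (cases "odd m")
    case False
    show ?thesis
    proof (rule reflect[of 2 1])
      show "Q (coord_reflection 2 (of_int 1) x)"
        by (rule column_odd[where n = n and m = "1 - m"])
          (use that False in \<open>auto simp: coord_reflection_component abs_le_iff\<close>)
    qed auto
  qed (use column_odd that in blast)
  moreover obtain n m where "in_cell n m x"
    using ex_cell by metis
  ultimately show ?thesis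
    unfolding Q_def by blast
qed

text \<open>The description defining \<open>zorich\<close> is proper: existence is
  \<open>zorich_graph_total\<close>, uniqueness is \<open>zorich_graph_cell_value\<close>.\<close>

lemma zorich_cell_value:
  assumes "in_cell n m x"
  shows "zorich h x = cell_value n m x"
proof -
  obtain y where "zorich_graph x y"
    using zorich_graph_total by blast
  then have "zorich_graph x (cell_value n m x)"
    using zorich_graph_cell_value[of x y n m] assms by simp
  then show ?thesis
    unfolding zorich_def equivariant_extension_def
    by (rule the_equality) (rule zorich_graph_cell_value[OF _ assms])
qed

lemma norm_zorich: "norm (zorich h x) = exp (x $ 3)"
proof -
  obtain n m where nm: "in_cell n m x"
    using ex_cell by metis
  then show ?thesis
    using h_hemisphere[OF fold_in_square[OF nm]]
    by (simp add: zorich_cell_value[OF nm] cell_value_def)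
qed

text \<open>The central cell covers the nonzero points with nonnegative third coordinate; its mirror
  image in the plane x1 = 1 covers the others.\<close>

lemma zorich_surj:
  assumes "y \<noteq> 0"
  shows "\<exists>x. zorich h x = y"
proof -
  have up: "\<exists>x. in_cell 0 0 x \<and> zorich h x = z" if "z \<noteq> 0" "0 \<le> z $ 3" for z
  proof -
    have "(1 / norm z) *\<^sub>R z \<in> upper_hemisphere"
      using that by (simp add: upper_hemisphere_def)
    then obtain u where u: "u \<in> unit_square" "(1 / norm z) *\<^sub>R z = h u"
      unfolding image[symmetric] by blast
    define x where "x = vec3 (u $ 1) (u $ 2) (ln (norm z))"
    have cell: "in_cell 0 0 x"
      using u by (simp add: x_def unit_square_def)
    have [simp]: "vector [u $ 1, u $ 2] = u"
      by (simp add: vec_eq_iff forall_2)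
    have "zorich h x = z"
      using that unfolding zorich_cell_value[OF cell]
      by (simp add: cell_value_def x_def fold_coord_def parity_sign_def u(2)[symmetric])
    then show ?thesis
      using cell by blast
  qed
  show ?thesis
  proof (cases "0 \<le> y $ 3")
    case True
    then show ?thesis using up assms by blast
  next
    case False
    have "flip3 y \<noteq> 0"
      using assms norm_flip3[of y] by (metis norm_eq_zero)
    then obtain x where x: "in_cell 0 0 x" "zorich h x = flip3 y"
      using up[of "flip3 y"] False by (auto simp: coord_reflection_component)
    define x' where "x' = coord_reflection 1 1 x"
    have "in_cell 1 0 x'"
      using x(1) by (simp add: x'_def coord_reflection_component)
    then have "zorich h x' = cell_value 1 0 x'"
      by (rule zorich_cell_value)
    also have "\<dots> = flip3 (cell_value 0 0 x)"
      using fold_coord_reflect[of 1 1 "x $ 1"]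
      by (simp add: cell_value_def x'_def coord_reflection_component flip3_scaleR)
    also have "\<dots> = y"
      using x zorich_cell_value[OF x(1)] by simp
    finally show ?thesis by blast
  qed
qed

text \<open>If the two points lie in cells of different parity, they are mapped to the equator; one of
  them then has a neighbouring cell of the right parity.\<close>

lemma zorich_fibre:
  assumes "zorich h x = zorich h y"
  obtains n m n' m' where
    "even (n + m) \<longleftrightarrow> even (n' + m')"
    "fold_coord n (x $ 1) = fold_coord n' (y $ 1)" "fold_coord m (x $ 2) = fold_coord m' (y $ 2)"
proof -
  obtain n m where nm: "in_cell n m x"
    using ex_cell by metis
  obtain n' m' where nm': "in_cell n' m' y"
    using ex_cell by metis
  define u :: "real^2" where "u = vector [fold_coord n (x $ 1), fold_coord m (x $ 2)]"
  define v :: "real^2" where "v = vector [fold_coord n' (y $ 1), fold_coord m' (y $ 2)]"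
  have uv: "u \<in> unit_square" "v \<in> unit_square"
    using fold_in_square[OF nm] fold_in_square[OF nm'] by (simp_all add: u_def v_def)
  have "exp (x $ 3) = exp (y $ 3)"
    using assms norm_zorich by metis
  then have h_eq: "(if even (n + m) then id else flip3) (h u) = (if even (n' + m') then id else flip3) (h v)"
    using assms unfolding zorich_cell_value[OF nm] zorich_cell_value[OF nm']
    by (simp add: cell_value_def u_def v_def)
  show thesis
  proof (cases "even (n + m) \<longleftrightarrow> even (n' + m')")
    case True
    then have "h u = h v"
      using h_eq by (auto simp: flip3_eq_iff split: if_splits)
    then have "u = v"
      using inj_on_h uv by (auto dest: inj_onD)
    then show thesis
      using True by (intro that[of n m n' m']) (auto simp: u_def v_def vec_eq_iff forall_2)
  next
    case False
    then have "h u = flip3 (h v)"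
      using h_eq by (auto simp: flip3_eq_iff split: if_splits)
    then have comps: "h u $ 1 = h v $ 1" "h u $ 2 = h v $ 2" "h u $ 3 = - (h v $ 3)"
      by (auto simp: coord_reflection_component)
    then have zero: "h u $ 3 = 0" "h v $ 3 = 0"
      using h_hemisphere[OF uv(1)] h_hemisphere[OF uv(2)] by auto
    then have "h u = h v"
      using comps by (simp add: vec_eq_iff forall_3)
    then have "u = v"
      using inj_on_h uv by (auto dest: inj_onD)
    then have eq: "fold_coord n (x $ 1) = fold_coord n' (y $ 1)"
        "fold_coord m (x $ 2) = fold_coord m' (y $ 2)"
      by (auto simp: u_def v_def vec_eq_iff forall_2)
    consider "\<bar>fold_coord n (x $ 1)\<bar> = 1" | "\<bar>fold_coord m (x $ 2)\<bar> = 1"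
      using equator_iff_boundary[OF uv(1)] zero by (auto simp: u_def)
    then show thesis
    proof cases
      case 1
      then obtain k where "fold_coord k (x $ 1) = fold_coord n (x $ 1)" "odd (n + k)"
        using neighbour_cell by metis
      then show thesis
        using False eq by (intro that[of k m n' m']) auto
    next
      case 2
      then obtain k where "fold_coord k (x $ 2) = fold_coord m (x $ 2)" "odd (m + k)"
        using neighbour_cell by metis
      then show thesis
        using False eq by (intro that[of n k n' m']) auto
    qed
  qed
qed

section \<open>Odd power maps\<close>

lemma in_cell_if_fold:
  assumes "fold_coord n (x $ 1) = u" "fold_coord m (x $ 2) = v" "\<bar>u\<bar> \<le> 1" "\<bar>v\<bar> \<le> 1"
  shows "in_cell n m x"
  using assms by (auto simp: fold_coord_def parity_sign_def split: if_splits)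

text \<open>Makes the power map well defined. Points of one fibre have the same folded coordinates
  and the same total parity, and multiplication by an odd number respects both.\<close>

lemma zorich_odd_multiple:
  assumes eq: "zorich h x = zorich h y" and d: "odd d"
  shows "zorich h (real d *\<^sub>R x) = zorich h (real d *\<^sub>R y)"
proof -
  obtain n m n' m' where nm: "even (n + m) \<longleftrightarrow> even (n' + m')"
    "fold_coord n (x $ 1) = fold_coord n' (y $ 1)" "fold_coord m (x $ 2) = fold_coord m' (y $ 2)"
    using zorich_fibre[OF eq] .
  define u where "u = fold_coord n' (y $ 1)"
  define v where "v = fold_coord m' (y $ 2)"
  obtain a where a: "\<bar>real d * u - 2 * of_int a\<bar> \<le> 1"
    using ex_cell by blast
  obtain b where b: "\<bar>real d * v - 2 * of_int b\<bar> \<le> 1"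
    using ex_cell by blast
  define w where "w = fold_coord a (real d * u)"
  define z where "z = fold_coord b (real d * v)"
  have wz: "\<bar>w\<bar> \<le> 1" "\<bar>z\<bar> \<le> 1"
    using a b by (simp_all add: w_def z_def fold_coord_bounds)
  \<comment> \<open>The cell index supplied by \<open>fold_coord_odd_multiple\<close>. Since
    \<open>a\<close> and \<open>b\<close> serve both points, their parities cancel in the
    comparison.\<close>
  define N where "N k c = int d * k + (if even k then c else - c)" for k c :: int
  have parity: "even (N k c) \<longleftrightarrow> even (k + c)" for k c
    using d by (simp add: N_def)
  have fx: "fold_coord (N n a) ((real d *\<^sub>R x) $ 1) = w" "fold_coord (N m b) ((real d *\<^sub>R x) $ 2) = z"
    using fold_coord_odd_multiple[OF d nm(2) refl, where a = a]
      fold_coord_odd_multiple[OF d nm(3) refl, where a = b]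
    by (simp_all add: N_def w_def z_def u_def v_def)
  have fy: "fold_coord (N n' a) ((real d *\<^sub>R y) $ 1) = w" "fold_coord (N m' b) ((real d *\<^sub>R y) $ 2) = z"
    using fold_coord_odd_multiple[OF d refl refl, where n = n' and t = "y $ 1" and a = a]
      fold_coord_odd_multiple[OF d refl refl, where n = m' and t = "y $ 2" and a = b]
    by (simp_all add: N_def w_def z_def u_def v_def)
  have par: "even (N n a + N m b) \<longleftrightarrow> even (N n' a + N m' b)"
    using nm(1) by (simp add: parity) blast
  have "x $ 3 = y $ 3"
    using eq norm_zorich by (metis exp_inj_iff)
  then have "cell_value (N n a) (N m b) (real d *\<^sub>R x) = cell_value (N n' a) (N m' b) (real d *\<^sub>R y)"
    unfolding cell_value_def fx fy using par by simp
  then show ?thesis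
    using zorich_cell_value[OF in_cell_if_fold[OF fx wz]] zorich_cell_value[OF in_cell_if_fold[OF fy wz]]
    by simp
qed

text \<open>Existence: choose any preimage under \<open>zorich h\<close>, the choice being
  immaterial by \<open>zorich_odd_multiple\<close>. Uniqueness: \<open>zorich h\<close> reaches
  every nonzero point, and the value at 0 is prescribed.\<close>

lemma power_map_zorich:
  assumes "odd d"
  shows "power_map h d (zorich h x) = zorich h (real d *\<^sub>R x)"
proof -
  have nz: "zorich h x \<noteq> 0" for x
    using norm_zorich[of x] by (metis exp_not_eq_zero norm_zero)
  define p where "p y = (if y = 0 then 0 else zorich h (real d *\<^sub>R (SOME x. zorich h x = y)))" for y
  have p: "p 0 = 0 \<and> (\<forall>x. p (zorich h x) = zorich h (real d *\<^sub>R x))"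
  proof (intro conjI allI)
    fix x
    have "zorich h (SOME x'. zorich h x' = zorich h x) = zorich h x"
      by (rule someI) simp
    then have "zorich h (real d *\<^sub>R (SOME x'. zorich h x' = zorich h x)) = zorich h (real d *\<^sub>R x)"
      by (rule zorich_odd_multiple[OF _ assms])
    then show "p (zorich h x) = zorich h (real d *\<^sub>R x)"
      by (simp add: p_def nz)
  qed (simp add: p_def)
  have uniq: "q = p" if "q 0 = 0 \<and> (\<forall>x. q (zorich h x) = zorich h (real d *\<^sub>R x))" for q
  proof
    fix y
    show "q y = p y"
      using that p zorich_surj[of y] by (cases "y = 0") auto
  qed
  have "power_map h d = p"
    unfolding power_map_def by (rule the_equality, rule p, rule uniq)
  then show ?thesis
    using p by simp
qed

lemma norm_power_map:
  assumes "odd d" "y \<noteq> 0"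
  shows "norm (power_map h d y) = norm y ^ d"
proof -
  obtain x where x: "zorich h x = y"
    using zorich_surj[OF assms(2)] by blast
  show ?thesis
    unfolding x[symmetric] power_map_zorich[OF assms(1)] norm_zorich by (simp add: exp_of_nat_mult)
qed

end


section \<open>Radii and maximum modulus\<close>

locale radius_sequence =
  fixes lam :: "nat \<Rightarrow> real"
  assumes lam_ge_1: "n \<ge> 1 \<Longrightarrow> 1 \<le> lam n"
begin

abbreviation "R \<equiv> inner_radius lam"
abbreviation "S \<equiv> outer_radius lam"
abbreviation "C \<equiv> coef lam"

lemma R_pos: "0 < R n"
proof (induction n rule: induct_nat_012)
  case (ge2 n)
  have "0 < lam (Suc n)"
    using lam_ge_1[of "Suc n"] by simp
  then show ?case
    using ge2 by simp
qed simp_all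

lemma R_less_S: "R n < S n"
  using R_pos[of n] by (simp add: outer_radius_def)

lemma R_Suc: "n \<ge> 1 \<Longrightarrow> R (Suc n) = lam n * S n"
  by (cases n) (simp_all add: outer_radius_def)

lemma S_le_R_Suc: "n \<ge> 1 \<Longrightarrow> S n \<le> R (Suc n)"
  using lam_ge_1[of n] R_pos[of n] R_less_S[of n] by (simp add: R_Suc)

lemma R_mono: "n \<le> m \<Longrightarrow> R n \<le> R m"
proof (induction m rule: dec_induct)
  case (step m)
  \<comment> \<open>For \<open>m = 0\<close> both radii are 1.\<close>
  have "R m \<le> R (Suc m)"
    using S_le_R_Suc[of m] R_less_S[of m] by (cases m) auto
  then show ?case
    using step by simp
qed simp

lemma R_ge_1: "1 \<le> R n"
  using R_mono[of 0 n] by simp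

lemma C_pos: "0 < C n"
  by (induction n) (use R_pos in auto)

lemma C_le_1: "C n \<le> 1"
proof (induction n)
  case (Suc n)
  have "1 \<le> R (Suc n) ^ (2 * 3 ^ Suc n)"
    using R_ge_1 by (rule one_le_power)
  then have "C n / R (Suc n) ^ (2 * 3 ^ Suc n) \<le> 1"
    using Suc by (simp add: divide_le_eq_1)
  then show ?case
    by simp
qed simp

lemma ln_R_Suc: "n \<ge> 1 \<Longrightarrow> ln (R (Suc n)) = ln (R n) + ln (lam n) + 1 / 3 ^ n"
  using lam_ge_1[of n] R_pos[of n]
  by (simp add: R_Suc outer_radius_def ln_mult algebra_simps)

text \<open>Separates the freely chosen factors from the interpolating annuli, whose total
  contribution stays below 1/2.\<close>

lemma ln_R_eq_sum: "ln (R (Suc n)) = (\<Sum>j=1..n. ln (lam j)) + (\<Sum>j=1..n. 1 / 3 ^ j)"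
  by (induction n) (simp_all add: ln_R_Suc del: inner_radius.simps(3))

lemma ln_C_Suc: "ln (C (Suc n)) = ln (C n) - 2 * 3 ^ Suc n * ln (R (Suc n))"
  using C_pos[of n] R_pos[of "Suc n"] by (simp add: ln_div ln_realpow)

text \<open>The constant value of |f| on the sphere of radius \<open>R (Suc n)\<close>, as
  \<open>max_modulus_eq\<close> confirms.\<close>

definition modulus :: "nat \<Rightarrow> real" where
  "modulus n = C n * R (Suc n) ^ (3 ^ Suc n)"

lemma modulus_pos: "0 < modulus n"
  using C_pos R_pos by (simp add: modulus_def)

lemma ln_modulus: "ln (modulus n) = ln (C n) + 3 ^ Suc n * ln (R (Suc n))"
  using C_pos[of n] R_pos[of "Suc n"] by (simp add: modulus_def ln_mult ln_realpow)

text \<open>By the choice of \<open>C\<close>, the factor of ln R is 3^(n+2) - 2 * 3^(n+1) =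
  3^(n+1), which restores the previous value. The annulus adds 3^(n+2) / 3^(n+1) = 3, and the new
  factor is amplified by the full degree.\<close>

lemma ln_modulus_Suc: "ln (modulus (Suc n)) = ln (modulus n) + 3 + 3 ^ (n + 2) * ln (lam (Suc n))"
  using ln_R_Suc[of "Suc n"] unfolding ln_modulus ln_C_Suc
  by (simp add: algebra_simps del: inner_radius.simps(3))

text \<open>The annuli alone contribute this much, so the inner logarithm is positive for
  \<open>n \<ge> 1\<close> whatever the factors are.\<close>

lemma ln_modulus_lower: "3 * real n \<le> ln (modulus n)"
proof (induction n)
  case (Suc n)
  have "0 \<le> 3 ^ (n + 2) * ln (lam (Suc n))"
    using lam_ge_1[of "Suc n"] by simp
  then show ?case
    using Suc ln_modulus_Suc[of n] by (simp add: algebra_simps)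
qed (simp add: modulus_def)

text \<open>Keeps only the last jump; everything else is nonnegative.\<close>

lemma ln_modulus_ge: "n \<ge> 1 \<Longrightarrow> 3 ^ Suc n * ln (lam n) \<le> ln (modulus n)"
  using ln_modulus_Suc[of "n - 1"] ln_modulus_lower[of "n - 1"] by (cases n) auto

lemma ln_modulus_upper: "ln (modulus n) \<le> 3 ^ Suc n * ln (R (Suc n))"
  using C_le_1[of n] C_pos[of n] by (simp add: ln_modulus)

lemma modulus_gt_1: "n \<ge> 1 \<Longrightarrow> 1 < modulus n"
  using ln_modulus_lower[of n] modulus_pos[of n] by (smt (verit) ln_le_zero_iff of_nat_1 of_nat_mono)

section \<open>The map on the spheres of radius \<open>R (Suc n)\<close>\<close>

lemma R_Suc_gt_1: "n \<ge> 1 \<Longrightarrow> 1 < R (Suc n)"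
  using R_ge_1[of n] R_less_S[of n] S_le_R_Suc[of n] by linarith

text \<open>Distinct annuli of this kind are separated by interpolating shells of positive width, by
  \<open>R_less_S\<close>. This evaluates the \<open>THE\<close> in
  \<open>constructed_map\<close>.\<close>

lemma annulus_index_unique:
  assumes "n \<ge> 1" "norm x = R (Suc n)"
  shows "1 \<le> m \<and> x \<in> annulus (S m) (R (m + 1)) \<longleftrightarrow> m = n"
proof
  assume m: "1 \<le> m \<and> x \<in> annulus (S m) (R (m + 1))"
  have "\<not> m < n"
  proof
    assume "m < n"
    then have "R (Suc m) \<le> R n"
      by (intro R_mono) simp
    then show False
      using m assms R_less_S[of n] S_le_R_Suc[of n] by auto
  qed
  moreover have "\<not> n < m"
  proof
    assume "n < m"
    then have "R (Suc n) \<le> R m"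
      by (intro R_mono) simp
    then show False
      using m assms R_less_S[of m] by auto
  qed
  ultimately show "m = n"
    by simp
next
  assume "m = n"
  then show "1 \<le> m \<and> x \<in> annulus (S m) (R (m + 1))"
    using assms S_le_R_Suc[of n] by simp
qed

text \<open>The power annuli are tested before the interpolating ones, so on the common sphere the
  power formula applies.\<close>

lemma constructed_map_on_sphere:
  assumes "n \<ge> 1" "norm x = R (Suc n)"
  shows "constructed_map h lam x = C n *\<^sub>R power_map h (3 ^ (n + 1)) x"
proof -
  have "\<not> norm x \<le> R 1"
    using R_Suc_gt_1[OF assms(1)] assms(2) by simp
  moreover have "\<exists>m\<ge>1. x \<in> annulus (S m) (R (m + 1))"
    using annulus_index_unique[OF assms] assms(1) by blast
  moreover have "(THE m. 1 \<le> m \<and> x \<in> annulus (S m) (R (m + 1))) = n"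
    unfolding annulus_index_unique[OF assms] by simp
  ultimately show ?thesis
    unfolding constructed_map_def Let_def by simp
qed

lemma max_modulus_eq:
  assumes "zorich_base h" "n \<ge> 1"
  shows "max_modulus (R (Suc n)) (constructed_map h lam) = modulus n"
proof -
  have "norm (constructed_map h lam x) = modulus n" if "x \<in> sphere 0 (R (Suc n))" for x
  proof -
    have x: "norm x = R (Suc n)"
      using that by simp
    then have "x \<noteq> 0"
      using R_pos[of "Suc n"] by auto
    then show ?thesis
      using constructed_map_on_sphere[OF assms(2) x] C_pos[of n] x
        zorich_base.norm_power_map[OF assms(1), of "3 ^ (n + 1)" x]
      by (simp add: modulus_def)
  qed
  moreover have "sphere 0 (R (Suc n)) \<noteq> ({} :: (real^3) set)"
    using R_pos[of "Suc n"] by simp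
  ultimately show ?thesis
    unfolding max_modulus_def by simp
qed

end


section \<open>Choosing the sequence\<close>

lemma sum_inverse_powers_3_less: "(\<Sum>j=1..n. 1 / 3 ^ j :: real) < 1 / 2"
proof -
  have "(\<Sum>j=1..n. 1 / 3 ^ j :: real) = (1 - 1 / 3 ^ n) / 2"
  proof (induction n)
    case (Suc n)
    then have "(\<Sum>j=1..Suc n. 1 / 3 ^ j :: real) = (1 - 1 / 3 ^ n) / 2 + 1 / 3 ^ Suc n"
      by simp
    then show ?case
      by (simp add: field_simps)
  qed simp
  then show ?thesis
    by simp
qed

lemma rapid_growth:
  fixes \<eta> :: "nat \<Rightarrow> real"
  assumes h: "zorich_base h"
  shows "\<exists>lam. (\<forall>n\<ge>1. 1 \<le> lam n) \<and>
    filterlim (\<lambda>n. \<Prod>j=1..n. lam j) at_top sequentially \<and>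
    (\<exists>r :: nat \<Rightarrow> real. filterlim r at_top sequentially \<and>
      (\<forall>k\<ge>1. 1 < r k \<and> r k < 2 ^ k \<and> 1 < max_modulus (r k) (constructed_map h lam) \<and>
        \<eta> k \<le> ln (ln (max_modulus (r k) (constructed_map h lam))) / ln (r k)))"
proof -
  \<comment> \<open>The 10 offsets the size 1/10 of ln \<lambda> at a jump; the exponent dominates
    \<open>\<eta> k * ln (r k)\<close> because ln (r k) stays below k.\<close>
  have "\<exists>N. 10 * exp (\<bar>\<eta> k\<bar> * real k) < 3 ^ N" for k
    by (rule real_arch_pow) simp
  then obtain N where N: "10 * exp (\<bar>\<eta> k\<bar> * real k) < 3 ^ N k" for k
    by metis
  \<comment> \<open>Partial sums make the jump indices strictly increasing and at least
    \<open>N k\<close>.\<close>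
  define m where "m k = (\<Sum>i=1..k. Suc (N i))" for k
  have m_strict: "strict_mono m"
    by (rule strict_monoI_Suc) (simp add: m_def)
  have m_ge_1: "1 \<le> m k" if "k \<ge> 1" for k
    using strict_mono_less[OF m_strict, of 0 k] that by simp
  have m_ge: "N k \<le> m k" if "k \<ge> 1" for k
    using that unfolding m_def by (cases k) simp_all
  \<comment> \<open>The size 1/10 gives k/10 + 1/2 \<le> 2k/3 \<le> k ln 2 for k \<ge> 1, as
    \<open>r k < 2 ^ k\<close> demands. The index \<open>m 0 = 0\<close> never enters, since sums
    and products start at 1.\<close>
  define lam :: "nat \<Rightarrow> real" where "lam j = (if j \<in> range m then exp (1 / 10) else 1)" for j
  interpret radius_sequence lam
    by unfold_locales (simp add: lam_def)
  have sum_ln: "(\<Sum>j=1..m k. ln (lam j)) = real k / 10" for k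
  proof -
    have "(\<Sum>j=1..m k. ln (lam j)) = (\<Sum>j=1..m k. if j \<in> range m then 1 / 10 else 0)"
      by (intro sum.cong) (auto simp: lam_def)
    also have "\<dots> = (\<Sum>j\<in>{1..m k} \<inter> range m. 1 / 10)"
      by (rule sum.inter_restrict[symmetric]) simp
    also have "{1..m k} \<inter> range m = m ` {1..k}"
    proof (intro equalityI subsetI)
      fix j assume "j \<in> {1..m k} \<inter> range m"
      then obtain i where i: "j = m i" "1 \<le> m i" "m i \<le> m k"
        by auto
      have "i \<noteq> 0"
        using i(2) by (intro notI) (simp add: m_def)
      then show "j \<in> m ` {1..k}"
        using i strict_mono_less_eq[OF m_strict] by auto
    qed (use m_ge_1 strict_mono_less_eq[OF m_strict] in auto)
    also have "(\<Sum>j\<in>m ` {1..k}. 1 / 10 :: real) = real k / 10"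
      using strict_mono_imp_inj_on[OF m_strict] by (simp add: card_image inj_on_subset)
    finally show ?thesis .
  qed
  \<comment> \<open>The first of the radii \<open>R\<close> to include the k-th jump.\<close>
  define r where "r k = R (Suc (m k))" for k
  have r_pos: "0 < r k" for k
    by (simp add: r_def R_pos)
  have ln_r_ge: "real k / 10 \<le> ln (r k)" for k
    unfolding r_def ln_R_eq_sum sum_ln by (simp add: sum_nonneg)
  have ln_r_less: "ln (r k) < real k * ln 2" if "k \<ge> 1" for k
  proof -
    have "ln (r k) < real k / 10 + 1 / 2"
      unfolding r_def ln_R_eq_sum sum_ln using sum_inverse_powers_3_less by simp
    also have "\<dots> \<le> real k * (2 / 3)"
      using that by simp
    also have "\<dots> \<le> real k * ln 2"
      by (intro mult_left_mono ln2_ge_two_thirds) simp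
    finally show ?thesis .
  qed
  have r_top: "filterlim r at_top sequentially"
  proof (rule filterlim_at_top_mono)
    show "filterlim (\<lambda>k. exp (real k / 10)) at_top sequentially"
      by real_asymp
    have "exp (real k / 10) \<le> r k" for k
      using ln_r_ge[of k] r_pos[of k] by (simp only: ln_ge_iff)
    then show "\<forall>\<^sub>F k in sequentially. exp (real k / 10) \<le> r k"
      by simp
  qed
  have "filterlim (\<lambda>n. \<Prod>j=1..n. lam j) at_top sequentially"
    unfolding filterlim_at_top
  proof
    fix Z :: real
    have "filterlim (\<lambda>k. exp (real k / 10)) at_top sequentially"
      by real_asymp
    then obtain k where k: "Z \<le> exp (real k / 10)"
      unfolding filterlim_at_top eventually_sequentially by blast
    have "Z \<le> (\<Prod>j=1..n. lam j)" if "m k \<le> n" for n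
    proof -
      have "exp (real k / 10) = (\<Prod>j=1..m k. exp (ln (lam j)))"
        unfolding sum_ln[symmetric] by (simp add: exp_sum)
      also have "\<dots> = (\<Prod>j=1..m k. lam j)"
        by (intro prod.cong) (auto simp: lam_def)
      also have "\<dots> \<le> (\<Prod>j=1..n. lam j)"
        by (intro prod_mono2) (use that in \<open>auto simp: lam_def\<close>)
      finally show ?thesis
        using k by simp
    qed
    then show "\<forall>\<^sub>F n in sequentially. Z \<le> (\<Prod>j=1..n. lam j)"
      unfolding eventually_sequentially by blast
  qed
  moreover have "1 < r k \<and> r k < 2 ^ k \<and> 1 < max_modulus (r k) (constructed_map h lam) \<and>
      \<eta> k \<le> ln (ln (max_modulus (r k) (constructed_map h lam))) / ln (r k)" if k: "k \<ge> 1" for k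
  proof -
    have M: "max_modulus (r k) (constructed_map h lam) = modulus (m k)"
      unfolding r_def using h m_ge_1[OF k] by (rule max_modulus_eq)
    have r_gt: "1 < r k"
      unfolding r_def using m_ge_1[OF k] by (rule R_Suc_gt_1)
    have "r k = exp (ln (r k))"
      using r_pos by simp
    also have "\<dots> < exp (real k * ln 2)"
      using ln_r_less[OF k] by simp
    also have "\<dots> = 2 ^ k"
      by (simp add: exp_of_nat_mult)
    finally have r_less: "r k < 2 ^ k" .
    have "exp (\<bar>\<eta> k\<bar> * real k) \<le> 3 ^ N k * (1 / 10)"
      using N[of k] by simp
    also have "\<dots> \<le> 3 ^ Suc (m k) * (1 / 10)"
      using m_ge[OF k] by (intro mult_right_mono power_increasing) auto
    also have "\<dots> = 3 ^ Suc (m k) * ln (lam (m k))"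
      by (simp add: lam_def)
    also have "\<dots> \<le> ln (modulus (m k))"
      using m_ge_1[OF k] by (rule ln_modulus_ge)
    finally have exp_le: "exp (\<bar>\<eta> k\<bar> * real k) \<le> ln (modulus (m k))" .
    then have "0 < ln (modulus (m k))"
      by (rule less_le_trans[OF exp_gt_zero])
    then have "\<bar>\<eta> k\<bar> * real k \<le> ln (ln (modulus (m k)))"
      using exp_le by (simp add: ln_ge_iff)
    \<comment> \<open>The absolute value lets the upper bound for ln (r k) serve negative
      \<open>\<eta> k\<close> too.\<close>
    moreover have "\<eta> k * ln (r k) \<le> \<bar>\<eta> k\<bar> * real k"
    proof (rule mult_mono)
      have "real k * ln 2 \<le> real k * 1"
        by (intro mult_left_mono) (use ln_2_less_1 in auto)
      then show "ln (r k) \<le> real k"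
        using ln_r_less[OF k] by simp
    qed (use r_gt in auto)
    ultimately show ?thesis
      using r_gt r_less modulus_gt_1[OF m_ge_1[OF k]] unfolding M by (simp add: le_divide_eq)
  qed
  ultimately show ?thesis
    using r_top lam_ge_1 by blast
qed

lemma slow_growth:
  fixes \<epsilon> :: "nat \<Rightarrow> real"
  assumes h: "zorich_base h" and \<epsilon>: "\<forall>k\<ge>1. 0 < \<epsilon> k"
  shows "\<exists>lam. (\<forall>n\<ge>1. 1 \<le> lam n) \<and>
    filterlim (\<lambda>n. \<Prod>j=1..n. lam j) at_top sequentially \<and>
    (\<forall>k\<ge>2. 1 < inner_radius lam k \<and>
      1 < max_modulus (inner_radius lam k) (constructed_map h lam) \<and>
      ln (ln (max_modulus (inner_radius lam k) (constructed_map h lam))) / ln (inner_radius lam k)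
        \<le> \<epsilon> k)"
proof -
  \<comment> \<open>With t = ln (R k), this quotient is the bound that
    \<open>ln_modulus_upper\<close> yields for the degree 3^k.\<close>
  have "\<exists>T. \<forall>t\<ge>T. (real k * ln 3 + ln t) / t \<le> \<epsilon> k" if "k \<ge> 1" for k
  proof -
    have "((\<lambda>t. (real k * ln 3 + ln t) / t) \<longlongrightarrow> 0) at_top"
      by real_asymp
    then have "\<forall>\<^sub>F t in at_top. (real k * ln 3 + ln t) / t < \<epsilon> k"
      using \<epsilon> that by (intro order_tendstoD(2)) auto
    then show ?thesis
      unfolding eventually_at_top_linorder by (meson less_imp_le)
  qed
  then obtain T where T: "(real k * ln 3 + ln t) / t \<le> \<epsilon> k" if "k \<ge> 1" "t \<ge> T k" for k t
    by metis
  \<comment> \<open>The factor \<open>lam n\<close> enters \<open>R (Suc n)\<close>, hence the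
    shifted index of \<open>T\<close>; the maximum with 1 makes the product diverge.\<close>
  define lam where "lam n = exp (max 1 (T (Suc n)))" for n
  interpret radius_sequence lam
    by unfold_locales (simp add: lam_def)
  have "filterlim (\<lambda>n. \<Prod>j=1..n. lam j) at_top sequentially"
  proof (rule filterlim_at_top_mono)
    show "filterlim (\<lambda>n. exp (real n)) at_top sequentially"
      by real_asymp
    have "exp (real n) \<le> (\<Prod>j=1..n. lam j)" for n
    proof -
      have "exp (real n) = (\<Prod>j=1..n. exp 1)"
        by (simp add: exp_of_nat_mult[symmetric])
      also have "\<dots> \<le> (\<Prod>j=1..n. lam j)"
        by (intro prod_mono) (simp add: lam_def)
      finally show ?thesis .
    qed
    then show "\<forall>\<^sub>F n in sequentially. exp (real n) \<le> (\<Prod>j=1..n. lam j)"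
      by simp
  qed
  moreover have "1 < R k \<and> 1 < max_modulus (R k) (constructed_map h lam) \<and>
      ln (ln (max_modulus (R k) (constructed_map h lam))) / ln (R k) \<le> \<epsilon> k" if "k \<ge> 2" for k
  proof -
    obtain n where n: "k = Suc n" "n \<ge> 1"
      using \<open>k \<ge> 2\<close> by (cases k) auto
    have M: "max_modulus (R k) (constructed_map h lam) = modulus n"
      unfolding n(1) using h n(2) by (rule max_modulus_eq)
    have R_gt: "1 < R k"
      unfolding n(1) using n(2) by (rule R_Suc_gt_1)
    have "ln (lam n) \<le> ln (R k)"
      using ln_R_Suc[OF n(2)] R_ge_1[of n] by (simp add: n(1))
    then have "T k \<le> ln (R k)"
      by (simp add: lam_def n(1))
    have pos: "0 < ln (R k)" "0 < ln (modulus n)"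
      using R_gt modulus_gt_1[OF n(2)] by auto
    have "ln (ln (modulus n)) \<le> ln (3 ^ k * ln (R k))"
      using ln_modulus_upper[of n] pos unfolding n(1) by (subst ln_le_cancel_iff) auto
    also have "\<dots> = real k * ln 3 + ln (ln (R k))"
      using pos by (simp add: ln_mult ln_realpow)
    finally have "ln (ln (modulus n)) / ln (R k) \<le> (real k * ln 3 + ln (ln (R k))) / ln (R k)"
      using pos by (simp add: divide_right_mono)
    also have "\<dots> \<le> \<epsilon> k"
      using \<open>k \<ge> 2\<close> \<open>T k \<le> ln (R k)\<close> by (intro T) auto
    finally show ?thesis
      using R_gt modulus_gt_1[OF n(2)] unfolding M by simp
  qed
  ultimately show ?thesis
    using lam_ge_1 by blast
qed

text \<open>The conjuncts with \<open>1 <\<close> make numerator and denominator genuine: the inner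
  logarithm and the divisor are positive, so no default value of \<open>ln\<close> or of division
  intervenes.\<close>

theorem theorem20:
  fixes h :: "real^2 \<Rightarrow> real^3"
  assumes "bilipschitz_on unit_square h"
    and "h ` unit_square = upper_hemisphere"
    and "h 0 = vec3 0 0 1"
    and "orientation_preserving (zorich h)"
  shows
    "(\<forall>\<eta> :: nat \<Rightarrow> real. \<exists>lam :: nat \<Rightarrow> real.
        (\<forall>n\<ge>1. 1 \<le> lam n) \<and>
        filterlim (\<lambda>n. \<Prod>j=1..n. lam j) at_top sequentially \<and>
        (\<exists>r :: nat \<Rightarrow> real. filterlim r at_top sequentially \<and>
          (\<forall>k\<ge>1. 1 < r k \<and> r k < 2 ^ k \<and>
             1 < max_modulus (r k) (constructed_map h lam) \<and>
             \<eta> k \<le> ln (ln (max_modulus (r k) (constructed_map h lam))) / ln (r k))))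
     \<and>
     (\<forall>\<epsilon> :: nat \<Rightarrow> real. (\<forall>k\<ge>1. 0 < \<epsilon> k) \<longrightarrow> (\<exists>lam :: nat \<Rightarrow> real.
        (\<forall>n\<ge>1. 1 \<le> lam n) \<and>
        filterlim (\<lambda>n. \<Prod>j=1..n. lam j) at_top sequentially \<and>
        (\<forall>k\<ge>2. 1 < inner_radius lam k \<and>
           1 < max_modulus (inner_radius lam k) (constructed_map h lam) \<and>
           ln (ln (max_modulus (inner_radius lam k) (constructed_map h lam)))
             / ln (inner_radius lam k) \<le> \<epsilon> k)))"
proof -
  have "zorich_base h"
    using assms(1,2) by (rule zorich_base.intro)
  then show ?thesis
    using rapid_growth slow_growth by blast
qed

end
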